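(* For each integer $r\ge 2$ there are constants $0<c_r<C_r$ such that, for every integer $n\ge 2$, $$\frac{c_r}{n}\le \Delta_{\mathcal{PC}}(n)\le C_r\,\frac{\ln^{r-1}(n)}{n}.$$
   Context: For fixed $r\ge2$, $\mathcal{PC}$ is the set of $r$-tuples $\mathbf{x}=(x_1,\dots,x_r)$ of positive integers with $\gcd(x_i,x_j)=1$ for all $i\ne j$. For $n\ge1$ and $\boldsymbol{\alpha}=(\alpha_1,\dots,\alpha_r)\in[0,1]^r$ put $|\boldsymbol{\alpha}|=\alpha_1\cdots\alpha_r$ and $G(n,\boldsymbol{\alpha})=\#\{\mathbf{x}\in\mathcal{PC}: x_j\le n\alpha_j \text{ for } j=1,\dots,r\}$. With $\boldsymbol{1}=(1,\dots,1)$, the discrepancy function of $\mathcal{PC}$ is $$\Delta_{\mathcal{PC}}(n)=\sup_{\boldsymbol{\alpha}\in[0,1]^r}\bigg|\frac{G(n,\boldsymbol{\alpha})}{G(n,\boldsymbol{1})}-|\boldsymbol{\alpha}|\bigg|.$$ Here $\ln^{r-1}(n)=(\ln n)^{r-1}$. *)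

theory Defs
  imports Complex_Main "HOL-Library.FuncSet"
begin

text \<open>
  An \<open>r\<close>-tuple is an extensional function on the index set \<open>{1..r}\<close>. The value outside
  \<open>{1..r}\<close> is fixed, so each tuple is represented exactly once and cardinalities are right.
\<close>

definition PC :: "nat \<Rightarrow> (nat \<Rightarrow> nat) set" where
  "PC r = {x \<in> {1..r} \<rightarrow>\<^sub>E {0<..}. \<forall>i\<in>{1..r}. \<forall>j\<in>{1..r}. i \<noteq> j \<longrightarrow> gcd (x i) (x j) = 1}"

definition G :: "nat \<Rightarrow> nat \<Rightarrow> (nat \<Rightarrow> real) \<Rightarrow> nat" where
  "G r n \<alpha> = card {x \<in> PC r. \<forall>j\<in>{1..r}. real (x j) \<le> real n * \<alpha> j}"

definition discrepancy_PC :: "nat \<Rightarrow> nat \<Rightarrow> real" where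
  "discrepancy_PC r n =
     (SUP \<alpha> \<in> {1..r} \<rightarrow>\<^sub>E {0..1}. \<bar>real (G r n \<alpha>) / real (G r n (\<lambda>_. 1)) - (\<Prod>j=1..r. \<alpha> j)\<bar>)"

text \<open>
  \<open>card\<close> is applied to finite sets only, the denominator is nonzero for \<open>n \<ge> 1\<close>, and the supremum is taken
  over a nonempty bounded set, so none of these takes a default value.
\<close>

lemma finite_PC_box:
  "finite {x \<in> PC r. \<forall>j\<in>{1..r}. real (x j) \<le> real n * \<alpha> j}"
proof (rule finite_subset)
  show "{x \<in> PC r. \<forall>j\<in>{1..r}. real (x j) \<le> real n * \<alpha> j}
          \<subseteq> (\<Pi>\<^sub>E j\<in>{1..r}. {..nat \<lfloor>real n * \<alpha> j\<rfloor>})"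
    by (auto simp: PC_def PiE_iff extensional_def le_nat_floor)
qed (auto intro: finite_PiE)

lemma G_one_pos:
  assumes "n \<ge> 1"
  shows "G r n (\<lambda>_. 1) > 0"
proof -
  let ?B = "{x \<in> PC r. \<forall>j\<in>{1..r}. real (x j) \<le> real n * 1}"
  have "(\<lambda>j\<in>{1..r}. 1) \<in> ?B"
    using assms by (auto simp: PC_def)
  then have "?B \<noteq> {}" by force
  then show ?thesis
    using finite_PC_box[of r n "\<lambda>_. 1"] unfolding G_def card_gt_0_iff by (intro conjI)
qed

lemma G_le_G_one:
  assumes "\<alpha> \<in> {1..r} \<rightarrow>\<^sub>E {0..1}"
  shows "G r n \<alpha> \<le> G r n (\<lambda>_. 1)"
  unfolding G_def
proof (rule card_mono[OF finite_PC_box], clarify)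
  fix x j assume "\<forall>j\<in>{1..r}. real (x j) \<le> real n * \<alpha> j" "j \<in> {1..r}"
  moreover from this assms have "real n * \<alpha> j \<le> real n * 1"
    by (intro mult_left_mono) (auto dest: PiE_mem)
  ultimately show "real (x j) \<le> real n * 1" by force
qed

lemma bdd_above_discrepancy_PC:
  "bdd_above ((\<lambda>\<alpha>. \<bar>real (G r n \<alpha>) / real (G r n (\<lambda>_. 1)) - (\<Prod>j=1..r. \<alpha> j)\<bar>)
                ` ({1..r} \<rightarrow>\<^sub>E {0..1}))"
proof (rule bdd_aboveI2)
  fix \<alpha> :: "nat \<Rightarrow> real" assume \<alpha>: "\<alpha> \<in> {1..r} \<rightarrow>\<^sub>E {0..1}"
  have "0 \<le> real (G r n \<alpha>) / real (G r n (\<lambda>_. 1))" by simp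
  moreover have "real (G r n \<alpha>) / real (G r n (\<lambda>_. 1)) \<le> 1"
    using G_le_G_one[OF \<alpha>, of n] by (auto simp: divide_le_eq_1)
  moreover have "\<alpha> j \<in> {0..1}" if "j \<in> {1..r}" for j
    using \<alpha> that by (rule PiE_mem)
  then have "0 \<le> (\<Prod>j=1..r. \<alpha> j)" "(\<Prod>j=1..r. \<alpha> j) \<le> 1"
    by (auto intro!: prod_nonneg prod_le_1)
  ultimately show "\<bar>real (G r n \<alpha>) / real (G r n (\<lambda>_. 1)) - (\<Prod>j=1..r. \<alpha> j)\<bar> \<le> 1"
    by linarith
qed

end

theory Submission
  imports Defs "HOL-Analysis.Infinite_Sum" "HOL-Computational_Algebra.Primes"
begin

text \<open>
  Upper bound: following Toth, the pairwise coprime \<open>k\<close>-tuples in a box, with all entries also coprime to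
  the primes of a finite set \<open>P\<close>, are counted by induction on \<open>k\<close>. Fixing the last coordinate \<open>j\<close> replaces
  \<open>P\<close> by \<open>P \<union> prime_factors j\<close>, so the main term at step \<open>k\<close> is the density
  \<open>\<Prod>p\<in>P. (p - 1) / (p + k - 1)\<close>, and the inductive step averages this density over \<open>j\<close> coprime to \<open>P\<close>.
  The average is a convolution with a function on squarefree numbers, whose error is bounded by
  Rankin's trick with exponent \<open>1 / (1 + ln n)\<close>: each coordinate costs one logarithm. The main constant is
  positive because the Euler products are bounded below by telescoping products.

  Lower bound: for \<open>\<alpha> = (1 / (2 n), 1, ..., 1)\<close> the box contains no tuple, but it has volume \<open>1 / (2 n)\<close>.
\<close>

section \<open>Sums over squarefree numbers\<close>

text \<open>A squarefree number is represented by the set of its prime factors.\<close>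

definition prime_sets :: "nat set \<Rightarrow> nat set set" where
  "prime_sets P = {S. finite S \<and> (\<forall>p\<in>S. prime p) \<and> S \<inter> P = {}}"

text \<open>Integral comparison: by the mean value theorem, the antiderivative
  \<open>- (x powr -\<delta> / \<delta>)\<close> grows from \<open>m\<close> to \<open>Suc m\<close>
  by at least the new term of the sum. The subtracted
  \<open>real N powr -\<delta> / \<delta>\<close> lets the induction close; dropping it leaves a
  bound uniform in \<open>N\<close>.\<close>

lemma sum_powr_le_zeta_bound:
  fixes \<delta> :: real
  assumes "\<delta> > 0" "N \<ge> 1"
  shows "(\<Sum>d=1..N. real d powr -(1 + \<delta>)) \<le> 1 + 1 / \<delta> - real N powr -\<delta> / \<delta>"
  using assms(2)
proof (induction N rule: nat_induct_at_least)
  case base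
  then show ?case by simp
next
  case (Suc m)
  have m: "real m > 0" using Suc.hyps by simp
  have "\<exists>z>real m. z < real (Suc m) \<and>
          - (real (Suc m) powr -\<delta> / \<delta>) - (- (real m powr -\<delta> / \<delta>))
            = (real (Suc m) - real m) * z powr (-\<delta> - 1)"
  proof (rule MVT2)
    fix x :: real assume "real m \<le> x" "x \<le> real (Suc m)"
    then have "x > 0" using m by linarith
    then show "((\<lambda>x. - (x powr -\<delta> / \<delta>)) has_real_derivative x powr (-\<delta> - 1)) (at x)"
      using assms(1) by (auto intro!: derivative_eq_intros simp: field_simps)
  qed simp
  then obtain z where z: "z > real m" "z < real (Suc m)"
      "- (real (Suc m) powr -\<delta> / \<delta>) + real m powr -\<delta> / \<delta> = z powr (-\<delta> - 1)"
    by auto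
  have "real (Suc m) powr -(1 + \<delta>) \<le> z powr -(1 + \<delta>)"
    using z m assms(1) by (intro powr_mono2') auto
  also have "z powr -(1 + \<delta>) = z powr (-\<delta> - 1)"
    by (rule arg_cong[where f = "\<lambda>t. z powr t"]) simp
  finally show ?case using Suc.IH Suc.hyps z(3) by simp
qed

lemma prime_factors_prod_primes:
  assumes "S \<in> prime_sets P"
  shows "prime_factors (\<Prod>S) = S"
proof -
  have "prime_factors (prod (\<lambda>p. p) S) = \<Union>((prime_factors \<circ> (\<lambda>p. p)) ` S)"
    using assms by (intro prime_factors_prod) (auto simp: prime_sets_def)
  also have "\<dots> = S" using assms by (auto simp: prime_sets_def prime_prime_factors)
  finally show ?thesis by simp
qed

lemma prod_primes_pos: "S \<in> prime_sets P \<Longrightarrow> \<Prod>S > (0::nat)"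
  by (auto simp: prime_sets_def prime_gt_0_nat intro!: prod_pos)

lemma inj_on_prod_prime_sets: "inj_on (\<lambda>S. \<Prod>S) (prime_sets P)"
  by (metis (no_types, lifting) inj_onI prime_factors_prod_primes)

lemma prod_primes_dvd_iff:
  assumes "S \<in> prime_sets P" "j > 0"
  shows "\<Prod>S dvd j \<longleftrightarrow> S \<subseteq> prime_factors j"
proof
  assume "\<Prod>S dvd j"
  then show "S \<subseteq> prime_factors j"
    using dvd_prime_factors[of j "\<Prod>S"] prime_factors_prod_primes[OF assms(1)] assms(2) by simp
next
  assume sub: "S \<subseteq> prime_factors j"
  have "\<Prod>S dvd \<Prod>(prime_factors j)"
    using sub by (intro prod_dvd_prod_subset) auto
  also have "\<Prod>(prime_factors j) dvd (\<Prod>p\<in>prime_factors j. p ^ multiplicity p j)"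
    by (intro prod_dvd_prod) (auto simp: prime_factors_multiplicity intro!: dvd_power)
  also have "\<dots> = j" using assms(2) by (metis prime_factorization_nat)
  finally show "\<Prod>S dvd j" .
qed

lemma Pow_prime_sets: "Q \<in> prime_sets P \<Longrightarrow> S \<subseteq> Q \<Longrightarrow> S \<in> prime_sets P"
  by (auto simp: prime_sets_def intro: finite_subset)

lemma prod_one_plus_eq_sum_Pow:
  fixes g :: "'a \<Rightarrow> 'b :: comm_semiring_1"
  assumes "finite Q"
  shows "(\<Prod>p\<in>Q. 1 + g p) = (\<Sum>S\<in>Pow Q. \<Prod>p\<in>S. g p)"
  using prod_add[OF assms, of g "\<lambda>_. 1"] by (simp add: add.commute)

text \<open>Expanding the product yields \<open>real d powr -(1 + \<delta>)\<close> for the distinct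
  integers \<open>d = \<Prod>S\<close>, a part of a partial zeta sum. The bound does not depend on
  \<open>Q\<close>.\<close>

lemma prod_one_plus_powr_le:
  fixes \<delta> :: real
  assumes "\<delta> > 0" "Q \<in> prime_sets P"
  shows "(\<Prod>p\<in>Q. 1 + real p powr -(1 + \<delta>)) \<le> 1 + 1 / \<delta>"
proof -
  have Q: "finite Q" using assms(2) by (simp add: prime_sets_def)
  have "(\<Prod>p\<in>Q. 1 + real p powr -(1 + \<delta>)) = (\<Sum>S\<in>Pow Q. \<Prod>p\<in>S. real p powr -(1 + \<delta>))"
    by (rule prod_one_plus_eq_sum_Pow[OF Q])
  also have "\<dots> = (\<Sum>S\<in>Pow Q. real (\<Prod>S) powr -(1 + \<delta>))"
    by (intro sum.cong refl) (simp add: prod_powr_distrib[symmetric])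
  also have "\<dots> = (\<Sum>d\<in>(\<lambda>S. \<Prod>S) ` Pow Q. real d powr -(1 + \<delta>))"
    using inj_on_subset[OF inj_on_prod_prime_sets[of P], of "Pow Q"] Pow_prime_sets[OF assms(2)]
    by (subst sum.reindex) auto
  also have "\<dots> \<le> (\<Sum>d=1..\<Prod>Q. real d powr -(1 + \<delta>))"
  proof (intro sum_mono2)
    show "(\<lambda>S. \<Prod>S) ` Pow Q \<subseteq> {1..\<Prod>Q}"
    proof clarsimp
      fix S assume S: "S \<subseteq> Q"
      have "\<Prod>S dvd \<Prod>Q" using S Q by (intro prod_dvd_prod_subset)
      moreover have "\<Prod>Q > 0" "\<Prod>S > 0"
        using assms(2) S Pow_prime_sets prod_primes_pos by blast+
      ultimately show "Suc 0 \<le> \<Prod>S \<and> \<Prod>S \<le> \<Prod>Q" using dvd_imp_le by force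
    qed
  qed auto
  also have "\<dots> \<le> 1 + 1 / \<delta> - real (\<Prod>Q) powr -\<delta> / \<delta>"
    using prod_primes_pos[OF assms(2)] by (intro sum_powr_le_zeta_bound[OF assms(1)]) simp
  also have "\<dots> \<le> 1 + 1 / \<delta>" using assms(1) by simp
  finally show ?thesis .
qed

text \<open>Bernoulli's inequality compares each factor with a \<open>k\<close>-th power. Every unit
  of \<open>k\<close> thus costs one factor \<open>1 + 1 / \<delta>\<close>, which later becomes a
  logarithm.\<close>

lemma prod_one_plus_le_power:
  fixes \<delta> :: real and g :: "nat \<Rightarrow> real"
  assumes "\<delta> > 0" "Q \<in> prime_sets P"
    and g: "\<And>p. prime p \<Longrightarrow> 0 \<le> g p" "\<And>p. prime p \<Longrightarrow> g p \<le> real k * real p powr -(1 + \<delta>)"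
  shows "(\<Prod>p\<in>Q. 1 + g p) \<le> (1 + 1 / \<delta>) ^ k"
proof -
  have Q: "\<And>p. p \<in> Q \<Longrightarrow> prime p" using assms(2) by (simp add: prime_sets_def)
  have "(\<Prod>p\<in>Q. 1 + g p) \<le> (\<Prod>p\<in>Q. (1 + real p powr -(1 + \<delta>)) ^ k)"
  proof (intro prod_mono conjI)
    fix p assume "p \<in> Q"
    then have p: "prime p" by (rule Q)
    show "0 \<le> 1 + g p" using g(1)[OF p] by simp
    have "1 + g p \<le> 1 + real k * real p powr -(1 + \<delta>)" using g(2)[OF p] by simp
    also have "\<dots> \<le> (1 + real p powr -(1 + \<delta>)) ^ k"
      by (rule Bernoulli_inequality) (meson dual_order.trans neg_le_0_iff_le powr_ge_zero zero_le_one)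
    finally show "1 + g p \<le> (1 + real p powr -(1 + \<delta>)) ^ k" .
  qed
  also have "\<dots> = (\<Prod>p\<in>Q. 1 + real p powr -(1 + \<delta>)) ^ k" by (simp add: prod_power_distrib)
  also have "\<dots> \<le> (1 + 1 / \<delta>) ^ k"
    using prod_one_plus_powr_le[OF assms(1,2)] by (intro power_mono) (auto intro!: prod_nonneg)
  finally show ?thesis .
qed

text \<open>A finite family lies in the power set of its union, the extra terms are nonnegative, and
  over a full power set the sum factors into a finite Euler product.\<close>

lemma sum_prime_sets_le:
  fixes g :: "nat \<Rightarrow> real"
  assumes "finite F" "F \<subseteq> prime_sets P" "\<And>p. prime p \<Longrightarrow> 0 \<le> g p"
    and "\<And>Q. Q \<in> prime_sets P \<Longrightarrow> (\<Prod>p\<in>Q. 1 + g p) \<le> B"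
  shows "(\<Sum>S\<in>F. \<Prod>p\<in>S. g p) \<le> B"
proof -
  have Q: "\<Union>F \<in> prime_sets P" using assms(1,2) by (auto simp: prime_sets_def)
  have "(\<Sum>S\<in>F. \<Prod>p\<in>S. g p) \<le> (\<Sum>S\<in>Pow (\<Union>F). \<Prod>p\<in>S. g p)"
    using Q assms(3) by (intro sum_mono2) (auto simp: prime_sets_def intro!: prod_nonneg)
  also have "\<dots> = (\<Prod>p\<in>\<Union>F. 1 + g p)"
    using Q by (intro prod_one_plus_eq_sum_Pow[symmetric]) (simp add: prime_sets_def)
  also have "\<dots> \<le> B" by (rule assms(4)[OF Q])
  finally show ?thesis .
qed

lemma summable_on_prime_sets:
  fixes g :: "nat \<Rightarrow> real"
  assumes "\<And>p. prime p \<Longrightarrow> 0 \<le> g p"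
    and "\<And>Q. Q \<in> prime_sets P \<Longrightarrow> (\<Prod>p\<in>Q. 1 + g p) \<le> B"
  shows "(\<lambda>S. \<Prod>p\<in>S. g p) summable_on prime_sets P"
    and "infsum (\<lambda>S. \<Prod>p\<in>S. g p) (prime_sets P) \<le> B"
proof -
  show s: "(\<lambda>S. \<Prod>p\<in>S. g p) summable_on prime_sets P"
  proof (rule nonneg_bdd_above_summable_on)
    show "bdd_above (sum (\<lambda>S. \<Prod>p\<in>S. g p) ` {F. F \<subseteq> prime_sets P \<and> finite F})"
      using sum_prime_sets_le[where g = g and B = B] assms by (intro bdd_aboveI2[where M = B]) auto
  qed (auto simp: prime_sets_def intro!: prod_nonneg assms(1))
  show "infsum (\<lambda>S. \<Prod>p\<in>S. g p) (prime_sets P) \<le> B"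
    using sum_prime_sets_le[where g = g and B = B] assms by (intro infsum_le_finite_sums[OF s]) auto
qed

text \<open>Convolution: the product over \<open>prime_factors j\<close> expands into a sum over the
  squarefree divisors of \<open>j\<close>, and the two sums are exchanged. The common set
  \<open>Q\<close> makes the inner index set independent of \<open>j\<close>.\<close>

lemma sum_prod_prime_factors:
  fixes h :: "nat \<Rightarrow> real"
  assumes "finite J" "finite Q" "\<And>j. j \<in> J \<Longrightarrow> j > 0 \<and> prime_factors j \<subseteq> Q"
    and Q: "Q \<in> prime_sets P"
  shows "(\<Sum>j\<in>J. \<Prod>p\<in>prime_factors j. 1 + h p) =
         (\<Sum>S\<in>Pow Q. (\<Prod>p\<in>S. h p) * real (card {j\<in>J. \<Prod>S dvd j}))"
proof -
  have "(\<Sum>j\<in>J. \<Prod>p\<in>prime_factors j. 1 + h p) =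
        (\<Sum>j\<in>J. \<Sum>S\<in>Pow (prime_factors j). \<Prod>p\<in>S. h p)"
    by (intro sum.cong refl prod_one_plus_eq_sum_Pow) simp
  also have "\<dots> = (\<Sum>j\<in>J. \<Sum>S\<in>Pow Q. if \<Prod>S dvd j then \<Prod>p\<in>S. h p else 0)"
  proof (rule sum.cong[OF refl])
    fix j assume j: "j \<in> J"
    have "Pow (prime_factors j) = {S\<in>Pow Q. \<Prod>S dvd j}"
      using assms(3)[OF j] prod_primes_dvd_iff[of _ P j] Pow_prime_sets[OF Q] by auto
    then show "(\<Sum>S\<in>Pow (prime_factors j). \<Prod>p\<in>S. h p) =
        (\<Sum>S\<in>Pow Q. if \<Prod>S dvd j then \<Prod>p\<in>S. h p else 0)"
      by (simp only: sum.inter_filter[OF iffD2[OF finite_Pow_iff assms(2)]])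
  qed
  also have "\<dots> = (\<Sum>S\<in>Pow Q. \<Sum>j\<in>J. if \<Prod>S dvd j then \<Prod>p\<in>S. h p else 0)"
    by (rule sum.swap)
  also have "\<dots> = (\<Sum>S\<in>Pow Q. (\<Prod>p\<in>S. h p) * real (card {j\<in>J. \<Prod>S dvd j}))"
  proof (intro sum.cong refl)
    fix S
    have "(\<Sum>j\<in>J. if \<Prod>S dvd j then \<Prod>p\<in>S. h p else 0) = (\<Sum>j\<in>{j\<in>J. \<Prod>S dvd j}. \<Prod>p\<in>S. h p)"
      by (rule sum.inter_filter[OF assms(1), symmetric])
    then show "(\<Sum>j\<in>J. if \<Prod>S dvd j then \<Prod>p\<in>S. h p else 0) =
        (\<Prod>p\<in>S. h p) * real (card {j\<in>J. \<Prod>S dvd j})" by simp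
  qed
  finally show ?thesis .
qed

section \<open>Averages over integers coprime to a set of primes\<close>

definition coprime_upto :: "real \<Rightarrow> nat set \<Rightarrow> nat set" where
  "coprime_upto x P = {j. 0 < j \<and> real j \<le> x \<and> prime_factors j \<inter> P = {}}"

lemma finite_coprime_upto: "finite (coprime_upto x P)"
  by (rule finite_subset[of _ "{..nat \<lfloor>x\<rfloor>}"]) (auto simp: coprime_upto_def le_nat_floor)

text \<open>Division by \<open>\<Prod>S\<close> is the bijection. As \<open>S\<close> is disjoint
  from \<open>P\<close>, multiplying back by \<open>\<Prod>S\<close> brings in no prime of
  \<open>P\<close>.\<close>

lemma card_coprime_upto_multiples:
  assumes "S \<in> prime_sets P"
  shows "card {j\<in>coprime_upto x P. \<Prod>S dvd j} = card (coprime_upto (x / real (\<Prod>S)) P)"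
proof -
  have pos: "\<Prod>S > 0" by (rule prod_primes_pos[OF assms])
  have "{j\<in>coprime_upto x P. \<Prod>S dvd j} = (\<lambda>m. \<Prod>S * m) ` coprime_upto (x / real (\<Prod>S)) P"
  proof (intro set_eqI iffI)
    fix j assume "j \<in> {j\<in>coprime_upto x P. \<Prod>S dvd j}"
    then obtain m where m: "j = \<Prod>S * m" "\<Prod>S * m \<in> coprime_upto x P" by auto
    then have "m > 0" by (auto simp: coprime_upto_def)
    moreover have "prime_factors j = prime_factors (\<Prod>S) \<union> prime_factors m"
      unfolding m(1) using \<open>m > 0\<close> pos by (intro prime_factors_product) auto
    ultimately have "m \<in> coprime_upto (x / real (\<Prod>S)) P"
      using m pos by (auto simp: coprime_upto_def field_simps simp del: of_nat_prod)
    then show "j \<in> (\<lambda>m. \<Prod>S * m) ` coprime_upto (x / real (\<Prod>S)) P" using m by blast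
  next
    fix j assume "j \<in> (\<lambda>m. \<Prod>S * m) ` coprime_upto (x / real (\<Prod>S)) P"
    then obtain m where m: "j = \<Prod>S * m" "m \<in> coprime_upto (x / real (\<Prod>S)) P" by auto
    then have "m > 0" by (auto simp: coprime_upto_def)
    moreover have "prime_factors j = S \<union> prime_factors m"
      unfolding m(1) using \<open>m > 0\<close> pos prime_factors_prod_primes[OF assms]
      by (subst prime_factors_product) auto
    ultimately show "j \<in> {j\<in>coprime_upto x P. \<Prod>S dvd j}"
      using m pos assms
      by (auto simp: coprime_upto_def prime_sets_def field_simps simp del: of_nat_prod)
  qed
  moreover have "inj_on (\<lambda>m. \<Prod>S * m) (coprime_upto (x / real (\<Prod>S)) P)"
    using pos by (auto simp: inj_on_def)
  ultimately show ?thesis by (simp add: card_image)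
qed

text \<open>Legendre's sieve, one prime at a time: discarding the multiples of \<open>p\<close>
  subtracts the count for \<open>P\<close> up to \<open>x / p\<close>, so each prime doubles the
  error.\<close>

lemma card_coprime_upto:
  assumes "finite P" "\<And>p. p \<in> P \<Longrightarrow> prime p" "x \<ge> 0"
  shows "\<bar>real (card (coprime_upto x P)) - x * (\<Prod>p\<in>P. 1 - 1 / real p)\<bar> \<le> 2 ^ card P"
  using assms
proof (induction P arbitrary: x rule: finite_induct)
  case empty
  have "coprime_upto x {} = {1..nat \<lfloor>x\<rfloor>}"
    using empty by (auto simp: coprime_upto_def le_nat_floor) (metis le_nat_iff le_floor_iff zero_le_floor of_int_of_nat_eq)
  then have "real (card (coprime_upto x {})) = of_int \<lfloor>x\<rfloor>" using empty by simp
  then show ?case by simp linarith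
next
  case (insert p P)
  have p: "prime p" "p \<notin> P" using insert by auto
  then have p0: "real p > 0" by (simp add: prime_gt_0_nat)
  have S: "{p} \<in> prime_sets P" using p by (simp add: prime_sets_def)
  have "coprime_upto x P = coprime_upto x (insert p P) \<union> {j\<in>coprime_upto x P. \<Prod>{p} dvd j}"
    using p by (auto simp: coprime_upto_def prime_factors_dvd)
  moreover have "coprime_upto x (insert p P) \<inter> {j\<in>coprime_upto x P. \<Prod>{p} dvd j} = {}"
    using p by (auto simp: coprime_upto_def prime_factors_dvd)
  ultimately have "card (coprime_upto x P) =
      card (coprime_upto x (insert p P)) + card {j\<in>coprime_upto x P. \<Prod>{p} dvd j}"
    by (metis (no_types, lifting) card_Un_disjoint finite_Un finite_coprime_upto)
  then have eq: "real (card (coprime_upto x P)) =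
      real (card (coprime_upto x (insert p P))) + real (card (coprime_upto (x / real p) P))"
    unfolding card_coprime_upto_multiples[OF S] by simp
  define c where "c = (\<Prod>p\<in>P. 1 - 1 / real p)"
  have 1: "\<bar>real (card (coprime_upto x P)) - x * c\<bar> \<le> 2 ^ card P"
    unfolding c_def using insert by auto
  have 2: "\<bar>real (card (coprime_upto (x / real p) P)) - x / real p * c\<bar> \<le> 2 ^ card P"
    unfolding c_def using insert.prems p0 by (intro insert.IH) auto
  have 3: "x * (\<Prod>p\<in>insert p P. 1 - 1 / real p) = x * c - x / real p * c"
    using insert p0 by (simp add: c_def field_simps)
  have 4: "(2::real) ^ card (insert p P) = 2 ^ card P + 2 ^ card P" using insert by simp
  have "\<bar>a - (u - v)\<bar> \<le> e + e" if "\<bar>a' - u\<bar> \<le> e" "\<bar>b - v\<bar> \<le> e" "a' = a + b"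
    for a a' b u v e :: real using that by linarith
  from this[OF 1 2 eq] show ?case unfolding 3 4 .
qed

text \<open>Splitting by whether \<open>q\<close> lies in \<open>S\<close> pulls out the Euler
  factor \<open>1 + w q\<close>, since the sets with \<open>q\<close> contribute \<open>w q\<close>
  times those without. What remains is the Euler product over the primes outside
  \<open>P\<close>.\<close>

lemma infsum_prime_sets_eq:
  fixes w :: "nat \<Rightarrow> real"
  assumes "(\<lambda>S. \<Prod>p\<in>S. w p) summable_on prime_sets {}" "finite P" "\<And>p. p \<in> P \<Longrightarrow> prime p"
  shows "infsum (\<lambda>S. \<Prod>p\<in>S. w p) (prime_sets {}) =
           (\<Prod>p\<in>P. 1 + w p) * infsum (\<lambda>S. \<Prod>p\<in>S. w p) (prime_sets P)"
  using assms(2,3)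
proof (induction P rule: finite_induct)
  case empty
  then show ?case by simp
next
  case (insert q P)
  let ?w = "\<lambda>S. \<Prod>p\<in>S. w p"
  let ?A = "prime_sets (insert q P)"
  have q: "prime q" "q \<notin> P" using insert by auto
  have split: "prime_sets P = ?A \<union> insert q ` ?A"
  proof (intro set_eqI iffI)
    fix S assume S: "S \<in> prime_sets P"
    show "S \<in> ?A \<union> insert q ` ?A"
    proof (cases "q \<in> S")
      case True
      then have "S = insert q (S - {q})" by auto
      moreover have "S - {q} \<in> ?A" using S by (auto simp: prime_sets_def)
      ultimately show ?thesis by blast
    qed (use S in \<open>auto simp: prime_sets_def\<close>)
  qed (use q in \<open>auto simp: prime_sets_def\<close>)
  have disj: "?A \<inter> insert q ` ?A = {}" by (auto simp: prime_sets_def)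
  have inj: "inj_on (insert q) ?A"
    by (auto simp: inj_on_def prime_sets_def insert_ident)
  have s: "?w summable_on B" if "B \<subseteq> prime_sets {}" for B
    using summable_on_subset_banach[OF assms(1) that] .
  have "infsum ?w (prime_sets P) = infsum ?w ?A + infsum ?w (insert q ` ?A)"
    unfolding split using disj q by (intro infsum_Un_disjoint s) (auto simp: prime_sets_def)
  also have "infsum ?w (insert q ` ?A) = infsum (?w \<circ> insert q) ?A"
    by (rule infsum_reindex[OF inj])
  also have "\<dots> = infsum (\<lambda>S. w q * ?w S) ?A"
    by (intro infsum_cong) (auto simp: prime_sets_def)
  also have "\<dots> = w q * infsum ?w ?A" by (rule infsum_cmult_right')
  finally have "infsum ?w (prime_sets P) = (1 + w q) * infsum ?w ?A" by (simp add: algebra_simps)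
  then show ?case using insert by (simp add: algebra_simps)
qed

section \<open>Local densities and their Euler products\<close>

text \<open>Chosen so that \<open>1 + local_factor k p\<close> is
  \<open>(p - 1) / (p + k - 1)\<close>: the probability that \<open>p\<close> divides none of
  \<open>k\<close> random integers, given that it divides at most one of them.\<close>

definition local_factor :: "nat \<Rightarrow> nat \<Rightarrow> real" where
  "local_factor k p = - real k / (real p + real k - 1)"

definition coprime_density :: "nat \<Rightarrow> nat set \<Rightarrow> real" where
  "coprime_density k P = (\<Prod>p\<in>P. 1 + local_factor k p)"

text \<open>The Euler product of \<open>1 + local_factor k p / p\<close> over all primes, which is
  the mean value of \<open>coprime_density k (prime_factors j)\<close> over \<open>j\<close>. It is
  kept in expanded form so that it can be compared termwise with a convolution sum.\<close>

definition sieve_constant :: "nat \<Rightarrow> real" where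
  "sieve_constant k = infsum (\<lambda>S. \<Prod>p\<in>S. local_factor k p / real p) (prime_sets {})"

lemma local_factor_bounds:
  assumes "prime p"
  shows "\<bar>local_factor k p\<bar> \<le> real k / real p" "0 < 1 + local_factor k p" "1 + local_factor k p \<le> 1"
proof -
  have p: "real p \<ge> 2" using prime_ge_2_nat[OF assms] by simp
  have "\<bar>local_factor k p\<bar> = real k / (real p + real k - 1)"
    using p by (simp add: local_factor_def)
  also have "\<dots> \<le> real k / real p"
    \<comment> \<open>For \<open>k = 0\<close> the denominator \<open>p + k - 1\<close> is below
      \<open>p\<close>, but both numerators vanish.\<close>
    using p by (cases k) (auto intro!: divide_left_mono)
  finally show "\<bar>local_factor k p\<bar> \<le> real k / real p" .
  show "0 < 1 + local_factor k p" "1 + local_factor k p \<le> 1"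
    using p by (auto simp: local_factor_def field_simps)
qed

lemma coprime_density_bounds:
  assumes "\<And>p. p \<in> P \<Longrightarrow> prime p"
  shows "0 \<le> coprime_density k P" "coprime_density k P \<le> 1"
  using assms local_factor_bounds(2,3)[of _ k] unfolding coprime_density_def
  by (auto intro!: prod_nonneg prod_le_1 simp: less_imp_le)

lemma coprime_density_union:
  assumes "finite P" "finite Q" "P \<inter> Q = {}"
  shows "coprime_density k (P \<union> Q) = coprime_density k P * coprime_density k Q"
  unfolding coprime_density_def by (rule prod.union_disjoint[OF assms])

lemma powr_minus_one_plus:
  assumes "x > 0"
  shows "x powr -(1 + \<delta>) = x powr -\<delta> / (x :: real)"
proof -
  have "x powr -(1 + \<delta>) = x powr (-\<delta> - 1)" by (rule arg_cong[where f = "\<lambda>t. x powr t"]) simp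
  also have "\<dots> = x powr -\<delta> / x" using assms by (simp add: powr_diff)
  finally show ?thesis .
qed

text \<open>As \<open>local_factor k p\<close> has size at most \<open>k / p\<close>, the weight
  \<open>real p powr -\<delta>\<close> brings each factor into the range of the Bernoulli
  bound.\<close>

lemma summable_on_weighted_factors:
  assumes "\<delta> > 0"
  shows "(\<lambda>S. \<Prod>p\<in>S. \<bar>local_factor k p\<bar> * real p powr -\<delta>) summable_on prime_sets P"
    and "infsum (\<lambda>S. \<Prod>p\<in>S. \<bar>local_factor k p\<bar> * real p powr -\<delta>) (prime_sets P) \<le> (1 + 1 / \<delta>) ^ k"
proof -
  have bound: "(\<Prod>p\<in>Q. 1 + \<bar>local_factor k p\<bar> * real p powr -\<delta>) \<le> (1 + 1 / \<delta>) ^ k"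
    if "Q \<in> prime_sets P" for Q
  proof (rule prod_one_plus_le_power[OF assms that])
    fix p :: nat assume p: "prime p"
    have "\<bar>local_factor k p\<bar> * real p powr -\<delta> \<le> real k / real p * real p powr -\<delta>"
      by (intro mult_right_mono local_factor_bounds(1)[OF p]) simp
    also have "\<dots> = real k * real p powr -(1 + \<delta>)"
      using prime_gt_0_nat[OF p] by (subst powr_minus_one_plus) auto
    finally show "\<bar>local_factor k p\<bar> * real p powr -\<delta> \<le> real k * real p powr -(1 + \<delta>)" .
  qed auto
  show "(\<lambda>S. \<Prod>p\<in>S. \<bar>local_factor k p\<bar> * real p powr -\<delta>) summable_on prime_sets P"
    by (rule summable_on_prime_sets(1)[OF _ bound]) auto
  show "infsum (\<lambda>S. \<Prod>p\<in>S. \<bar>local_factor k p\<bar> * real p powr -\<delta>) (prime_sets P) \<le> (1 + 1 / \<delta>) ^ k"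
    by (rule summable_on_prime_sets(2)[OF _ bound]) auto
qed

lemma summable_on_sieve_constant:
  "(\<lambda>S. \<Prod>p\<in>S. local_factor k p / real p) summable_on prime_sets P"
proof (rule abs_summable_summable)
  \<comment> \<open>The instance \<open>\<delta> = 1\<close> of the weighted sum.\<close>
  have "(\<lambda>S. \<Prod>p\<in>S. \<bar>local_factor k p\<bar> * real p powr -1) summable_on prime_sets P"
    by (rule summable_on_weighted_factors) simp
  also have "?this \<longleftrightarrow> (\<lambda>S. norm (\<Prod>p\<in>S. local_factor k p / real p)) summable_on prime_sets P"
    by (intro summable_on_cong)
       (auto simp: abs_prod powr_minus_divide prime_sets_def prime_gt_0_nat intro!: prod.cong)
  finally show "(\<lambda>S. norm (\<Prod>p\<in>S. local_factor k p / real p)) summable_on prime_sets P" .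
qed

text \<open>Over all integers \<open>2 \<le> m \<le> M\<close> instead of primes, the Euler product telescopes.\<close>

lemma prod_telescope:
  assumes "M \<ge> 1"
  shows "(\<Prod>m=2..M. 1 + local_factor k m / real m) = (real M + real k) / (real M * (real k + 1))"
  using assms
proof (induction M rule: nat_induct_at_least)
  case base
  then show ?case by simp
next
  case (Suc m)
  have "(\<Prod>m=2..Suc m. 1 + local_factor k m / real m) =
     (1 + local_factor k (Suc m) / real (Suc m)) * ((real m + real k) / (real m * (real k + 1)))"
    using Suc by (simp add: prod.nat_ivl_Suc')
  also have "1 + local_factor k (Suc m) / real (Suc m) =
      real m * (real m + 1 + real k) / ((real m + 1) * (real m + real k))"
  proof -
    have "1 + (- b / (a + b)) / (a + 1) = a * (a + 1 + b) / ((a + 1) * (a + b))"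
      if "a > 0" "b \<ge> 0" for a b :: real
    proof -
      have "a + b > 0" using that by simp
      then show ?thesis using that by (simp add: divide_simps) (simp add: algebra_simps)
    qed
    from this[of "real m" "real k"] show ?thesis using Suc.hyps by (simp add: local_factor_def add.commute)
  qed
  also have "\<dots> * ((real m + real k) / (real m * (real k + 1))) =
     (real (Suc m) + real k) / (real (Suc m) * (real k + 1))"
  proof -
    have "a * q / (t * s) * (s / (a * u)) = q / (t * u)" if "a \<noteq> 0" "s \<noteq> 0" for a q s t u :: real
      using that by simp
    from this[of "real m" "real m + real k"] show ?thesis using Suc.hyps by (simp add: add_ac)
  qed
  finally show ?case .
qed

text \<open>All factors with \<open>m \<ge> 2\<close> lie between 0 and 1, so enlarging
  \<open>Q\<close> to the interval \<open>{2..M}\<close> only decreases the product, and there it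
  telescopes. \<open>M = \<Prod>Q\<close> serves as an upper bound for the members of
  \<open>Q\<close>.\<close>

lemma prod_local_factor_ge:
  assumes "Q \<in> prime_sets P"
  shows "1 / (real k + 1) \<le> (\<Prod>p\<in>Q. 1 + local_factor k p / real p)"
proof -
  define M where "M = \<Prod>Q"
  have M: "M \<ge> 1" using prod_primes_pos[OF assms] by (simp add: M_def)
  have fact: "0 \<le> 1 + local_factor k m / real m" "1 + local_factor k m / real m \<le> 1" if "m \<ge> 2" for m
  proof -
    define t where "t = real k / (real m + real k - 1)"
    have "0 \<le> t" "t \<le> 1" using that by (auto simp: t_def)
    then have "0 \<le> t / real m" "t / real m \<le> 1" using that by (auto simp: divide_le_eq)
    moreover have "local_factor k m / real m = - (t / real m)" by (simp add: local_factor_def t_def)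
    ultimately show "0 \<le> 1 + local_factor k m / real m" "1 + local_factor k m / real m \<le> 1" by auto
  qed
  have sub: "Q \<subseteq> {2..M}"
  proof
    fix p assume p: "p \<in> Q"
    then have "p dvd M" using assms unfolding M_def prime_sets_def by (intro dvd_prodI) auto
    then show "p \<in> {2..M}"
      using p assms M by (auto simp: prime_sets_def prime_ge_2_nat intro!: dvd_imp_le)
  qed
  have "1 / (real k + 1) \<le> (real M + real k) / (real M * (real k + 1))"
    using M divide_right_mono[of 1 "(real M + real k) / real M" "real k + 1"] by simp
  also have "\<dots> = (\<Prod>m=2..M. 1 + local_factor k m / real m)" by (rule prod_telescope[OF M, symmetric])
  also have "\<dots> = (\<Prod>m\<in>Q. 1 + local_factor k m / real m) * (\<Prod>m\<in>{2..M} - Q. 1 + local_factor k m / real m)"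
    using sub by (subst mult.commute, intro prod.subset_diff) auto
  also have "\<dots> \<le> (\<Prod>m\<in>Q. 1 + local_factor k m / real m) * 1"
    using sub fact by (intro mult_left_mono prod_nonneg prod_le_1) auto
  finally show ?thesis by simp
qed

text \<open>Partial sums over full power sets are finite Euler products, hence at least
  \<open>1 / (real k + 1)\<close>. Every finite family lies in such a power set, so one of these
  sums is closer than \<open>1 / (real k + 1)\<close> to the limit.\<close>

lemma sieve_constant_pos: "sieve_constant k > 0"
proof -
  let ?w = "\<lambda>S. \<Prod>p\<in>S. local_factor k p / real p"
  have "(sum ?w \<longlongrightarrow> sieve_constant k) (finite_subsets_at_top (prime_sets {}))"
    unfolding sieve_constant_def by (rule infsum_tendsto[OF summable_on_sieve_constant])
  then have "\<forall>\<^sub>F F in finite_subsets_at_top (prime_sets {}). dist (sum ?w F) (sieve_constant k) < 1 / (real k + 1)"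
    by (rule tendstoD) simp
  then obtain F where F: "finite F" "F \<subseteq> prime_sets {}"
    "\<And>F'. finite F' \<Longrightarrow> F \<subseteq> F' \<Longrightarrow> F' \<subseteq> prime_sets {} \<Longrightarrow> dist (sum ?w F') (sieve_constant k) < 1 / (real k + 1)"
    unfolding eventually_finite_subsets_at_top by metis
  have Q: "\<Union>F \<in> prime_sets {}" using F(1,2) by (auto simp: prime_sets_def)
  then have fin: "finite (\<Union>F)" by (simp add: prime_sets_def)
  have "dist (sum ?w (Pow (\<Union>F))) (sieve_constant k) < 1 / (real k + 1)"
    using fin Pow_prime_sets[OF Q] by (intro F(3)) auto
  moreover have "sum ?w (Pow (\<Union>F)) \<ge> 1 / (real k + 1)"
    using prod_local_factor_ge[OF Q, of k] prod_one_plus_eq_sum_Pow[OF fin, of "\<lambda>p. local_factor k p / real p"] by simp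
  ultimately show ?thesis by (simp add: dist_real_def)
qed

section \<open>Rankin's trick and the averages needed for the inductive step\<close>

lemma card_coprime_upto_le:
  assumes "x \<ge> 0"
  shows "real (card (coprime_upto x P)) \<le> x"
proof -
  have "card (coprime_upto x P) \<le> card {1..nat \<lfloor>x\<rfloor>}"
    by (intro card_mono) (auto simp: coprime_upto_def le_nat_floor)
  then have "real (card (coprime_upto x P)) \<le> real (nat \<lfloor>x\<rfloor>)" by simp
  also have "\<dots> \<le> x" using assms by (rule of_nat_floor)
  finally show ?thesis .
qed

lemma coprime_upto_empty: "x < 1 \<Longrightarrow> coprime_upto x P = {}"
  by (auto simp: coprime_upto_def)

text \<open>The choice balances two costs: \<open>real n powr \<delta>\<close> stays bounded while
  \<open>1 / \<delta>\<close> is only logarithmic. The summand 1 in the denominator covers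
  \<open>n = 1\<close>.\<close>

lemma rankin_exponent:
  assumes "n \<ge> (1::nat)" "\<delta> = 1 / (1 + ln (real n))"
  shows "0 < \<delta>" "\<delta> \<le> 1" "1 + 1 / \<delta> \<le> 2 * (1 + ln (real n))" "real n powr \<delta> \<le> exp 1"
proof -
  have l: "ln (real n) \<ge> 0" using assms(1) by simp
  show "0 < \<delta>" "\<delta> \<le> 1" "1 + 1 / \<delta> \<le> 2 * (1 + ln (real n))"
    using l by (auto simp: assms(2) field_simps)
  show "real n powr \<delta> \<le> exp 1"
  proof -
    have "t / (1 + t) \<le> 1" if "t \<ge> 0" for t :: real using that by simp
    from this[OF l] show ?thesis using assms(1) by (simp add: powr_def assms(2))
  qed
qed

text \<open>Rankin's trick: with this exponent both the terms up to \<open>n\<close> and the tail are dominated by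
  \<open>(n / d) powr \<delta>\<close>.\<close>

lemma rankin_bound:
  assumes "n \<ge> (1::nat)" "\<delta> = 1 / (1 + ln (real n))" "d \<ge> (1::nat)"
  shows "min 1 (real n / real d) \<le> exp 1 * real d powr -\<delta>"
proof -
  note \<delta> = rankin_exponent[OF assms(1,2)]
  have "min 1 (real n / real d) \<le> (real n / real d) powr \<delta>"
  proof (cases "d \<le> n")
    case True
    then have "1 \<le> (real n / real d) powr \<delta>" using assms \<delta>(1) by (intro ge_one_powr_ge_zero) auto
    then show ?thesis by linarith
  next
    case False
    have "(real n / real d) powr 1 \<le> (real n / real d) powr \<delta>"
      using False assms \<delta> by (intro powr_mono') auto
    then show ?thesis using assms by simp
  qed
  also have "\<dots> = real n powr \<delta> * real d powr -\<delta>"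
    using assms by (simp add: powr_divide powr_minus_divide)
  also have "\<dots> \<le> exp 1 * real d powr -\<delta>" using \<delta>(4) by (intro mult_right_mono) auto
  finally show ?thesis .
qed

lemma coprime_upto_support:
  assumes "0 \<le> x" "x \<le> real n"
  shows "{p. prime p \<and> p \<le> n \<and> p \<notin> P} \<in> prime_sets P"
    and "j \<in> coprime_upto x P \<Longrightarrow> j > 0 \<and> prime_factors j \<subseteq> {p. prime p \<and> p \<le> n \<and> p \<notin> P}"
proof -
  show "{p. prime p \<and> p \<le> n \<and> p \<notin> P} \<in> prime_sets P"
    by (auto simp: prime_sets_def)
  assume j: "j \<in> coprime_upto x P"
  then have "j \<le> n" using assms by (auto simp: coprime_upto_def)
  with j show "j > 0 \<and> prime_factors j \<subseteq> {p. prime p \<and> p \<le> n \<and> p \<notin> P}"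
    by (auto simp: coprime_upto_def prime_factors_dvd intro: order_trans[OF dvd_imp_le])
qed

text \<open>The sieve error for \<open>P \<union> prime_factors j\<close> carries the factor
  \<open>2 ^ card (prime_factors j)\<close>; this bounds its total over \<open>j\<close>. The power
  counts the squarefree divisors of \<open>j\<close>, so the convolution applies with
  \<open>h = 1\<close>.\<close>

lemma sum_two_power_le:
  assumes "n \<ge> (1::nat)" "0 \<le> x" "x \<le> real n"
  shows "(\<Sum>j\<in>coprime_upto x P. 2 ^ card (prime_factors j)) \<le> 2 * exp 1 * (real n * (1 + ln (real n)))"
proof -
  define \<delta> where "\<delta> = 1 / (1 + ln (real n))"
  note \<delta> = rankin_exponent[OF assms(1) \<delta>_def]
  define Q where "Q = {p. prime p \<and> p \<le> n \<and> p \<notin> P}"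
  have Q: "Q \<in> prime_sets P" unfolding Q_def by (rule coprime_upto_support[OF assms(2,3)])
  then have fin: "finite Q" by (simp add: prime_sets_def)
  have "(\<Sum>j\<in>coprime_upto x P. 2 ^ card (prime_factors j)) =
      (\<Sum>j\<in>coprime_upto x P. \<Prod>p\<in>prime_factors j. 1 + (1::real))" by simp
  also have "\<dots> = (\<Sum>S\<in>Pow Q. (\<Prod>p\<in>S. 1) * real (card {j\<in>coprime_upto x P. \<Prod>S dvd j}))"
    using coprime_upto_support(2)[OF assms(2,3)]
    by (intro sum_prod_prime_factors[OF finite_coprime_upto fin _ Q]) (auto simp: Q_def)
  also have "\<dots> \<le> (\<Sum>S\<in>Pow Q. exp 1 * real n * (\<Prod>p\<in>S. real p powr -(1 + \<delta>)))"
  proof (intro sum_mono)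
    fix S assume "S \<in> Pow Q"
    then have S: "S \<in> prime_sets P" using Pow_prime_sets[OF Q] by auto
    define d where "d = \<Prod>S"
    have d: "d \<ge> 1" using prod_primes_pos[OF S] by (simp add: d_def)
    have y: "0 \<le> x / real d" "x / real d \<le> real n / real d"
      using assms by (auto intro: divide_right_mono)
    have "real (card {j\<in>coprime_upto x P. d dvd j}) = real (card (coprime_upto (x / real d) P))"
      unfolding d_def card_coprime_upto_multiples[OF S] ..
    \<comment> \<open>The factor \<open>min\<close> comes for free, as the count is zero once
      \<open>x / d < 1\<close>; it is what Rankin's bound turns into the convergence factor
      \<open>real d powr -\<delta>\<close>.\<close>
    also have "\<dots> \<le> real n / real d * min 1 (real n / real d)"
    proof (cases "x / real d < 1")
      case True
      then show ?thesis using d by (simp add: coprime_upto_empty)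
    next
      case False
      then have "min 1 (real n / real d) = 1" using y by linarith
      then show ?thesis using card_coprime_upto_le[OF y(1), of P] y by simp
    qed
    also have "\<dots> \<le> real n / real d * (exp 1 * real d powr -\<delta>)"
      by (intro mult_left_mono rankin_bound[OF assms(1) \<delta>_def d]) auto
    also have "\<dots> = exp 1 * real n * real d powr -(1 + \<delta>)"
      using d by (subst powr_minus_one_plus) (auto simp: field_simps)
    also have "real d powr -(1 + \<delta>) = (\<Prod>p\<in>S. real p powr -(1 + \<delta>))"
      by (simp add: d_def prod_powr_distrib[symmetric])
    finally show "(\<Prod>p\<in>S. 1) * real (card {j\<in>coprime_upto x P. \<Prod>S dvd j})
        \<le> exp 1 * real n * (\<Prod>p\<in>S. real p powr -(1 + \<delta>))" by (simp add: d_def)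
  qed
  also have "\<dots> = exp 1 * real n * (\<Prod>p\<in>Q. 1 + real p powr -(1 + \<delta>))"
    by (simp add: prod_one_plus_eq_sum_Pow[OF fin] sum_distrib_left)
  also have "\<dots> \<le> exp 1 * real n * (2 * (1 + ln (real n)))"
    using prod_one_plus_powr_le[OF \<delta>(1) Q] \<delta>(3) by (intro mult_left_mono) auto
  finally show ?thesis by (simp add: algebra_simps)
qed

text \<open>After convolution each count up to \<open>x / \<Prod>S\<close> is replaced by its sieve
  main term \<open>x / \<Prod>S * c\<close>, and the sum is completed to all of
  \<open>prime_sets P\<close>. The main terms add up to \<open>x * c * W\<close>, with
  \<open>W\<close> the Euler product outside \<open>P\<close>; Rankin's trick controls both the
  sieve errors and the completed tail.\<close>

lemma sum_coprime_density_approx: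
  assumes "n \<ge> (1::nat)" "0 \<le> x" "x \<le> real n" "P \<in> prime_sets {}"
  shows "\<bar>coprime_density k P * (\<Sum>j\<in>coprime_upto x P. coprime_density k (prime_factors j))
           - sieve_constant k * coprime_density (Suc k) P * x\<bar>
         \<le> 2 ^ card P * exp 1 * (2 * (1 + ln (real n))) ^ k"
proof -
  have P: "finite P" "\<And>p. p \<in> P \<Longrightarrow> prime p" using assms(4) by (auto simp: prime_sets_def)
  define \<delta> where "\<delta> = 1 / (1 + ln (real n))"
  note \<delta> = rankin_exponent[OF assms(1) \<delta>_def]
  define Q where "Q = {p. prime p \<and> p \<le> n \<and> p \<notin> P}"
  have Q: "Q \<in> prime_sets P" unfolding Q_def by (rule coprime_upto_support[OF assms(2,3)])
  then have fin: "finite Q" by (simp add: prime_sets_def)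
  define h where "h = (\<lambda>S. \<Prod>p\<in>S. local_factor k p)"
  define C where "C = (\<lambda>S. real (card (coprime_upto (x / real (\<Prod>S)) P)))"
  define c where "c = (\<Prod>p\<in>P. 1 - 1 / real p)"
  define T where "T = (\<Sum>j\<in>coprime_upto x P. coprime_density k (prime_factors j))"
  define W where "W = infsum (\<lambda>S. \<Prod>p\<in>S. local_factor k p / real p) (prime_sets P)"
  have c: "0 \<le> c" "c \<le> 1"
    unfolding c_def using P prime_gt_0_nat by (auto intro!: prod_nonneg prod_le_1 simp: Suc_leI)
  have "T = (\<Sum>S\<in>Pow Q. h S * real (card {j\<in>coprime_upto x P. \<Prod>S dvd j}))"
    unfolding T_def h_def coprime_density_def
    using coprime_upto_support(2)[OF assms(2,3)]
    by (intro sum_prod_prime_factors[OF finite_coprime_upto fin _ Q]) (auto simp: Q_def)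
  also have "\<dots> = (\<Sum>S\<in>Pow Q. h S * C S)"
    using card_coprime_upto_multiples[of _ P x] Pow_prime_sets[OF Q]
    by (intro sum.cong) (auto simp: C_def)
  finally have "((\<lambda>S. h S * C S) has_sum T) (Pow Q)"
    using fin by (intro has_sum_finiteI) auto
  also have "?this \<longleftrightarrow> ((\<lambda>S. h S * C S) has_sum T) (prime_sets P)"
  \<comment> \<open>A set with a prime beyond \<open>n\<close> has
    \<open>\<Prod>S > n \<ge> x\<close>, so its count is zero and the finite sum extends to all of
    \<open>prime_sets P\<close>.\<close>
  proof (intro has_sum_cong_neutral)
    fix S assume "S \<in> prime_sets P - Pow Q"
    then have S: "S \<in> prime_sets P" and "\<not> S \<subseteq> Q" by auto
    then obtain p where p: "p \<in> S" "p \<notin> Q" by auto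
    moreover have "prime p" "p \<notin> P" using S p(1) by (auto simp: prime_sets_def)
    ultimately have "p > n" by (simp add: Q_def)
    have "p dvd \<Prod>S" using S p by (intro dvd_prodI) (auto simp: prime_sets_def)
    then have "p \<le> \<Prod>S" using prod_primes_pos[OF S] by (intro dvd_imp_le)
    then have "real n < real (\<Prod>S)" using \<open>p > n\<close> by linarith
    then have "x / real (\<Prod>S) < 1" using assms by (simp del: of_nat_prod)
    then show "h S * C S = 0" by (simp add: C_def coprime_upto_empty)
  qed (use Pow_prime_sets[OF Q] in auto)
  finally have sT: "((\<lambda>S. h S * C S) has_sum T) (prime_sets P)" .
  have "((\<lambda>S. \<Prod>p\<in>S. local_factor k p / real p) has_sum W) (prime_sets P)"
    unfolding W_def by (rule has_sum_infsum[OF summable_on_sieve_constant])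
  then have "((\<lambda>S. (\<Prod>p\<in>S. local_factor k p / real p) * - (x * c)) has_sum W * - (x * c)) (prime_sets P)"
    by (rule has_sum_cmult_left)
  from has_sum_add[OF sT this]
  have s1: "((\<lambda>S. h S * C S + (\<Prod>p\<in>S. local_factor k p / real p) * - (x * c)) has_sum T + W * - (x * c)) (prime_sets P)" .
  let ?g = "\<lambda>S. \<Prod>p\<in>S. \<bar>local_factor k p\<bar> * real p powr -\<delta>"
  have s2: "((\<lambda>S. 2 ^ card P * exp 1 * ?g S) has_sum 2 ^ card P * exp 1 * infsum ?g (prime_sets P)) (prime_sets P)"
    by (intro has_sum_cmult_right has_sum_infsum summable_on_weighted_factors \<delta>)
  have "norm (T + W * - (x * c)) \<le> 2 ^ card P * exp 1 * infsum ?g (prime_sets P)"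
  proof (rule norm_infsum_le[OF s1 s2])
    fix S assume S: "S \<in> prime_sets P"
    define d where "d = \<Prod>S"
    have d: "d \<ge> 1" using prod_primes_pos[OF S] by (simp add: d_def)
    have y: "0 \<le> x / real d" "x / real d \<le> real n / real d"
      using assms by (auto intro: divide_right_mono)
    \<comment> \<open>One bound for both ranges: for \<open>d \<le> n\<close> it is the sieve error,
      and for \<open>d > n\<close> the count vanishes and only the main term, at most
      \<open>n / d\<close>, is left.\<close>
    have "\<bar>C S - x / real d * c\<bar> \<le> 2 ^ card P * min 1 (real n / real d)"
    proof (cases "d \<le> n")
      case True
      then have "min 1 (real n / real d) = 1" using d by simp
      then show ?thesis using card_coprime_upto[OF P y(1)] by (simp add: C_def c_def d_def)
    next
      case False
      then have lt: "real n / real d < 1" using d by simp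
      then have "C S = 0" using y coprime_upto_empty[of "x / real d" P] by (simp add: C_def d_def)
      moreover have "0 \<le> x / real d * c" by (intro mult_nonneg_nonneg y c)
      ultimately have "\<bar>C S - x / real d * c\<bar> = x / real d * c" by linarith
      also have "\<dots> \<le> real n / real d * 1" using y c by (intro mult_mono) auto
      also have "\<dots> \<le> 2 ^ card P * (real n / real d)"
        using mult_right_mono[of 1 "2 ^ card P" "real n / real d"] by simp
      finally show ?thesis using lt by simp
    qed
    also have "\<dots> \<le> 2 ^ card P * (exp 1 * real d powr -\<delta>)"
      by (intro mult_left_mono rankin_bound[OF assms(1) \<delta>_def d]) simp
    finally have 1: "\<bar>C S - x / real d * c\<bar> \<le> 2 ^ card P * exp 1 * real d powr -\<delta>" by simp
    have "h S * C S + (\<Prod>p\<in>S. local_factor k p / real p) * - (x * c) = h S * (C S - x / real d * c)"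
      by (simp add: h_def d_def prod_dividef algebra_simps)
    then have "norm (h S * C S + (\<Prod>p\<in>S. local_factor k p / real p) * - (x * c)) =
       \<bar>h S\<bar> * \<bar>C S - x / real d * c\<bar>" by (simp add: abs_mult)
    also have "\<dots> \<le> \<bar>h S\<bar> * (2 ^ card P * exp 1 * real d powr -\<delta>)" using 1 by (intro mult_left_mono) auto
    also have "\<bar>h S\<bar> * (2 ^ card P * exp 1 * real d powr -\<delta>) = 2 ^ card P * exp 1 * ?g S"
      by (simp add: h_def d_def prod.distrib abs_prod prod_powr_distrib[symmetric])
    finally show "norm (h S * C S + (\<Prod>p\<in>S. local_factor k p / real p) * - (x * c)) \<le> 2 ^ card P * exp 1 * ?g S" .
  qed
  also have "\<dots> \<le> 2 ^ card P * exp 1 * (2 * (1 + ln (real n))) ^ k"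
  proof (intro mult_left_mono)
    have "infsum ?g (prime_sets P) \<le> (1 + 1 / \<delta>) ^ k" by (rule summable_on_weighted_factors[OF \<delta>(1)])
    also have "\<dots> \<le> (2 * (1 + ln (real n))) ^ k" using \<delta> by (intro power_mono) auto
    finally show "infsum ?g (prime_sets P) \<le> (2 * (1 + ln (real n))) ^ k" .
  qed auto
  finally have err: "\<bar>T - W * (x * c)\<bar> \<le> 2 ^ card P * exp 1 * (2 * (1 + ln (real n))) ^ k" by simp
  have "sieve_constant k * coprime_density (Suc k) P = coprime_density k P * c * W"
  proof -
    have "sieve_constant k = (\<Prod>p\<in>P. 1 + local_factor k p / real p) * W"
      unfolding sieve_constant_def W_def by (rule infsum_prime_sets_eq[OF summable_on_sieve_constant P])
    \<comment> \<open>This identity holds prime by prime, both sides being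
      \<open>(p - 1)^2 / (p * (p + k - 1))\<close>. It is the reason why averaging turns the density
      for \<open>k\<close> into the density for \<open>Suc k\<close>.\<close>
    moreover have "(\<Prod>p\<in>P. 1 + local_factor k p / real p) * coprime_density (Suc k) P = coprime_density k P * c"
      unfolding coprime_density_def c_def prod.distrib[symmetric]
    proof (intro prod.cong refl)
      fix p assume "p \<in> P"
      then have p: "real p \<ge> 2" using prime_ge_2_nat[OF P(2)] by fastforce
      then have "real p + real k - 1 \<noteq> 0" "real p + real k \<noteq> 0" "real p \<noteq> 0" by auto
      then show "(1 + local_factor k p / real p) * (1 + local_factor (Suc k) p) =
          (1 + local_factor k p) * (1 - 1 / real p)"
        unfolding local_factor_def of_nat_Suc by (simp add: divide_simps) (simp add: algebra_simps)
    qed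
    ultimately show ?thesis by (metis (no_types, lifting) mult.assoc mult.commute)
  qed
  then have "coprime_density k P * T - sieve_constant k * coprime_density (Suc k) P * x = coprime_density k P * (T - W * (x * c))"
    by (simp add: algebra_simps)
  then have "\<bar>coprime_density k P * T - sieve_constant k * coprime_density (Suc k) P * x\<bar> = coprime_density k P * \<bar>T - W * (x * c)\<bar>"
    using coprime_density_bounds[OF P(2), of P k] by (simp add: abs_mult)
  also have "\<dots> \<le> 1 * \<bar>T - W * (x * c)\<bar>"
    using coprime_density_bounds[OF P(2), of P k] by (intro mult_right_mono) auto
  finally show ?thesis using err by (simp add: T_def)
qed

section \<open>Pairwise coprime tuples\<close>

definition coprime_tuples :: "nat \<Rightarrow> (nat \<Rightarrow> real) \<Rightarrow> nat set \<Rightarrow> (nat \<Rightarrow> nat) set" where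
  "coprime_tuples k X P =
     {x \<in> PC k. \<forall>j\<in>{1..k}. real (x j) \<le> X j \<and> prime_factors (x j) \<inter> P = {}}"

lemma gcd_eq_1_iff_prime_factors_disjoint:
  fixes a b :: nat
  assumes "a > 0" "b > 0"
  shows "gcd a b = 1 \<longleftrightarrow> prime_factors a \<inter> prime_factors b = {}"
proof
  assume "gcd a b = 1"
  then have "coprime a b" by (simp add: coprime_iff_gcd_eq_1)
  then show "prime_factors a \<inter> prime_factors b = {}"
    using assms by (auto simp: prime_factors_dvd dest: coprime_common_divisor)
next
  assume disj: "prime_factors a \<inter> prime_factors b = {}"
  show "gcd a b = 1"
  proof (rule ccontr)
    assume "gcd a b \<noteq> 1"
    then obtain p where "prime p" "p dvd gcd a b" using prime_factor_nat by blast
    then have "p \<in> prime_factors a \<inter> prime_factors b" using assms by (auto simp: prime_factors_dvd)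
    then show False using disj by simp
  qed
qed

lemma finite_coprime_tuples: "finite (coprime_tuples k X P)"
  by (rule finite_subset[OF _ finite_PC_box[of k 1 X]]) (auto simp: coprime_tuples_def)

lemma PC_Suc_update:
  assumes "x \<in> PC k" "j > 0" "\<And>i. i \<in> {1..k} \<Longrightarrow> gcd (x i) j = 1"
  shows "x(Suc k := j) \<in> PC (Suc k)"
  using assms by (auto simp: PC_def PiE_iff extensional_def gcd.commute atLeastAtMostSuc_conv)

lemma PC_Suc_restrict:
  assumes "y \<in> PC (Suc k)"
  shows "restrict y {1..k} \<in> PC k" "y (Suc k) > 0" "(restrict y {1..k})(Suc k := y (Suc k)) = y"
    and "\<And>i. i \<in> {1..k} \<Longrightarrow> gcd (y i) (y (Suc k)) = 1" "\<And>i. i \<in> {1..k} \<Longrightarrow> y i > 0"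
proof -
  have y: "\<And>i. i \<in> {1..Suc k} \<Longrightarrow> y i > 0" "y \<in> extensional {1..Suc k}"
    "\<And>i j. i \<in> {1..Suc k} \<Longrightarrow> j \<in> {1..Suc k} \<Longrightarrow> i \<noteq> j \<Longrightarrow> gcd (y i) (y j) = 1"
    using assms unfolding PC_def PiE_iff by auto
  show "restrict y {1..k} \<in> PC k" using y(1,3) by (auto simp: PC_def)
  show "y (Suc k) > 0" using y(1) by simp
  show "(restrict y {1..k})(Suc k := y (Suc k)) = y"
    using y(2) by (auto simp: fun_eq_iff extensional_def)
  show "gcd (y i) (y (Suc k)) = 1" if "i \<in> {1..k}" for i using y(3)[of i "Suc k"] that by auto
  show "y i > 0" if "i \<in> {1..k}" for i using y(1)[of i] that by auto
qed

text \<open>Fibring over the last coordinate \<open>j\<close>: being coprime to \<open>j\<close>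
  means avoiding its primes, so this condition is absorbed into the set \<open>P\<close>.\<close>

lemma card_coprime_tuples_Suc:
  "card (coprime_tuples (Suc k) X P) =
     (\<Sum>j\<in>coprime_upto (X (Suc k)) P. card (coprime_tuples k X (P \<union> prime_factors j)))"
proof -
  let ?A = "SIGMA j:coprime_upto (X (Suc k)) P. coprime_tuples k X (P \<union> prime_factors j)"
  have "bij_betw (\<lambda>(j, x). x(Suc k := j)) ?A (coprime_tuples (Suc k) X P)"
  proof (rule bij_betw_byWitness[where f' = "\<lambda>y. (y (Suc k), restrict y {1..k})"])
    show "\<forall>a\<in>?A. (case (case a of (j, x) \<Rightarrow> x(Suc k := j)) of y \<Rightarrow> (y (Suc k), restrict y {1..k})) = a"
      by (auto simp: coprime_tuples_def PC_def PiE_iff extensional_def fun_eq_iff)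
    show "\<forall>y\<in>coprime_tuples (Suc k) X P. (case (y (Suc k), restrict y {1..k}) of (j, x) \<Rightarrow> x(Suc k := j)) = y"
      using PC_Suc_restrict(3) by (auto simp: coprime_tuples_def)
    show "(\<lambda>(j, x). x(Suc k := j)) ` ?A \<subseteq> coprime_tuples (Suc k) X P"
    proof clarify
      fix j x assume j: "j \<in> coprime_upto (X (Suc k)) P"
        and x: "x \<in> coprime_tuples k X (P \<union> prime_factors j)"
      have j0: "j > 0" using j by (simp add: coprime_upto_def)
      have "gcd (x i) j = 1" if "i \<in> {1..k}" for i
      proof -
        have "x i > 0" "prime_factors (x i) \<inter> prime_factors j = {}"
          using x that by (auto simp: coprime_tuples_def PC_def PiE_iff)
        then show ?thesis using gcd_eq_1_iff_prime_factors_disjoint[OF _ j0] by blast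
      qed
      moreover have "x \<in> PC k" using x by (simp add: coprime_tuples_def)
      ultimately have "x(Suc k := j) \<in> PC (Suc k)" using j0 by (intro PC_Suc_update)
      then show "x(Suc k := j) \<in> coprime_tuples (Suc k) X P"
        using j x by (auto simp: coprime_tuples_def coprime_upto_def)
    qed
    show "(\<lambda>y. (y (Suc k), restrict y {1..k})) ` coprime_tuples (Suc k) X P \<subseteq> ?A"
    proof clarify
      fix y assume y: "y \<in> coprime_tuples (Suc k) X P"
      then have PC: "y \<in> PC (Suc k)" by (simp add: coprime_tuples_def)
      have "prime_factors (y i) \<inter> prime_factors (y (Suc k)) = {}" if "i \<in> {1..k}" for i
        using PC_Suc_restrict[OF PC] that gcd_eq_1_iff_prime_factors_disjoint by blast
      moreover have "prime_factors (y i) \<inter> P = {}" "real (y i) \<le> X i" if "i \<in> {1..k}" for i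
        using y that by (auto simp: coprime_tuples_def)
      ultimately have "restrict y {1..k} \<in> coprime_tuples k X (P \<union> prime_factors (y (Suc k)))"
        using PC_Suc_restrict(1)[OF PC] unfolding coprime_tuples_def
        by (simp add: Int_Un_distrib)
      moreover have "y (Suc k) \<in> coprime_upto (X (Suc k)) P"
        using y PC_Suc_restrict(2)[OF PC] by (simp add: coprime_tuples_def coprime_upto_def)
      ultimately show "y (Suc k) \<in> coprime_upto (X (Suc k)) P \<and>
          restrict y {1..k} \<in> coprime_tuples k X (P \<union> prime_factors (y (Suc k)))" by simp
    qed
  qed
  then have "card (coprime_tuples (Suc k) X P) = card ?A" by (simp add: bij_betw_same_card)
  also have "\<dots> = (\<Sum>j\<in>coprime_upto (X (Suc k)) P. card (coprime_tuples k X (P \<union> prime_factors j)))"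
    by (simp add: card_SigmaI finite_coprime_upto finite_coprime_tuples)
  finally show ?thesis .
qed

lemma coprime_tuples_0: "coprime_tuples 0 X P = {\<lambda>_. undefined}"
  by (auto simp: coprime_tuples_def PC_def)

text \<open>\<open>K\<close> depends on \<open>k\<close> only. The error is multiplied by
  \<open>real n * (1 + ln (real n))\<close> so that the exponent \<open>k - 1\<close> becomes
  \<open>k\<close> and \<open>k = 0\<close> can start the induction. The factor
  \<open>2 ^ card P\<close> is multiplicative when \<open>P\<close> grows by the primes of
  \<open>j\<close>.\<close>

lemma card_coprime_tuples_approx:
  "\<exists>K\<ge>0. \<forall>n\<ge>1. \<forall>P\<in>prime_sets {}. \<forall>X. (\<forall>j\<in>{1..k}. 0 \<le> X j \<and> X j \<le> real n) \<longrightarrow>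
     (real n * (1 + ln (real n))) *
       \<bar>real (card (coprime_tuples k X P)) - (\<Prod>i<k. sieve_constant i) * coprime_density k P * (\<Prod>j=1..k. X j)\<bar>
     \<le> K * 2 ^ card P * (real n * (1 + ln (real n))) ^ k"
proof (induction k)
  case 0
  show ?case
    \<comment> \<open>There is one empty tuple and \<open>local_factor 0 p = 0\<close>, so the
      approximation is exact.\<close>
    by (rule exI[of _ 0]) (simp add: coprime_tuples_0 coprime_density_def local_factor_def)
next
  case (Suc k)
  define A where "A = (\<Prod>i<k. sieve_constant i)"
  have A: "A \<ge> 0" unfolding A_def by (intro prod_nonneg) (simp add: less_imp_le sieve_constant_pos)
  from Suc obtain K where K: "K \<ge> 0" and IH: "\<And>n P X. n \<ge> 1 \<Longrightarrow> P \<in> prime_sets {} \<Longrightarrow>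
      (\<And>j. j \<in> {1..k} \<Longrightarrow> 0 \<le> X j \<and> X j \<le> real n) \<Longrightarrow>
      (real n * (1 + ln (real n))) *
       \<bar>real (card (coprime_tuples k X P)) - A * coprime_density k P * (\<Prod>j=1..k. X j)\<bar>
     \<le> K * 2 ^ card P * (real n * (1 + ln (real n))) ^ k"
    unfolding A_def by blast
  \<comment> \<open>The first summand collects the errors of the induction hypothesis over all
    \<open>j\<close>; the second is the error made in averaging the main terms.\<close>
  define K' where "K' = K * (2 * exp 1) + A * exp 1 * 2 ^ k"
  show ?case
  proof (intro exI[of _ K'] conjI allI impI ballI)
    show "K' \<ge> 0" using K A by (simp add: K'_def)
    fix n :: nat and P X
    assume n: "n \<ge> 1" and P: "P \<in> prime_sets {}" and X: "\<forall>j\<in>{1..Suc k}. 0 \<le> X j \<and> X j \<le> real n"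
    define L where "L = 1 + ln (real n)"
    define M where "M = real n * L"
    have L: "L \<ge> 1" using n by (simp add: L_def)
    then have M: "M \<ge> 0" by (simp add: M_def)
    define x where "x = X (Suc k)"
    have x: "0 \<le> x" "x \<le> real n" using X by (auto simp: x_def)
    define V where "V = (\<Prod>j=1..k. X j)"
    have V: "0 \<le> V" "V \<le> real n ^ k"
    proof -
      show "0 \<le> V" unfolding V_def using X by (intro prod_nonneg) auto
      have "V \<le> (\<Prod>j=1..k. real n)" unfolding V_def using X by (intro prod_mono) auto
      then show "V \<le> real n ^ k" by simp
    qed
    define J where "J = coprime_upto x P"
    define N where "N = (\<lambda>j. real (card (coprime_tuples k X (P \<union> prime_factors j))))"
    define f where "f = (\<lambda>j. coprime_density k (prime_factors j))"
    define s where "s = coprime_density k P"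
    have finP: "finite P" using P by (simp add: prime_sets_def)
    have disj: "P \<inter> prime_factors j = {}" if "j \<in> J" for j
      using that by (auto simp: J_def coprime_upto_def)
    have each: "M * \<bar>N j - A * (s * f j) * V\<bar> \<le> K * 2 ^ card P * M ^ k * 2 ^ card (prime_factors j)"
      if j: "j \<in> J" for j
    proof -
      have "P \<union> prime_factors j \<in> prime_sets {}" using P by (auto simp: prime_sets_def)
      from IH[OF n this, of X] X have "M * \<bar>N j - A * coprime_density k (P \<union> prime_factors j) * V\<bar>
          \<le> K * 2 ^ card (P \<union> prime_factors j) * M ^ k"
        unfolding M_def L_def N_def V_def by simp
      moreover have "coprime_density k (P \<union> prime_factors j) = s * f j"
        unfolding s_def f_def by (rule coprime_density_union[OF finP _ disj[OF j]]) simp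
      moreover have "card (P \<union> prime_factors j) = card P + card (prime_factors j)"
        by (rule card_Un_disjoint[OF finP _ disj[OF j]]) simp
      ultimately show ?thesis by (simp add: power_add algebra_simps)
    qed
    have card: "real (card (coprime_tuples (Suc k) X P)) = (\<Sum>j\<in>J. N j)"
      by (simp add: card_coprime_tuples_Suc J_def x_def N_def)
    \<comment> \<open>First error: each fibre count is replaced by its main term.\<close>
    have "M * \<bar>(\<Sum>j\<in>J. N j) - A * V * (s * (\<Sum>j\<in>J. f j))\<bar> = M * \<bar>\<Sum>j\<in>J. N j - A * (s * f j) * V\<bar>"
      by (simp add: sum_subtractf sum_distrib_left algebra_simps)
    also have "\<dots> \<le> M * (\<Sum>j\<in>J. \<bar>N j - A * (s * f j) * V\<bar>)"
      using M by (intro mult_left_mono sum_abs)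
    also have "\<dots> \<le> (\<Sum>j\<in>J. K * 2 ^ card P * M ^ k * 2 ^ card (prime_factors j))"
      unfolding sum_distrib_left by (intro sum_mono each)
    also have "\<dots> = K * 2 ^ card P * M ^ k * (\<Sum>j\<in>J. 2 ^ card (prime_factors j))"
      by (simp add: sum_distrib_left)
    also have "\<dots> \<le> K * 2 ^ card P * M ^ k * (2 * exp 1 * M)"
      using sum_two_power_le[OF n x, of P] K M unfolding J_def M_def L_def by (intro mult_left_mono) auto
    finally have 1: "M * \<bar>(\<Sum>j\<in>J. N j) - A * V * (s * (\<Sum>j\<in>J. f j))\<bar>
        \<le> K * (2 * exp 1) * 2 ^ card P * M ^ Suc k" by (simp add: algebra_simps)
    \<comment> \<open>Second error: the average of the densities is replaced by its mean value.
      Multiplied by \<open>V \<le> real n ^ k\<close>, the power \<open>L ^ k\<close> completes to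
      \<open>M ^ k\<close>.\<close>
    have "\<bar>s * (\<Sum>j\<in>J. f j) - sieve_constant k * coprime_density (Suc k) P * x\<bar>
        \<le> 2 ^ card P * exp 1 * (2 * L) ^ k"
      unfolding s_def J_def f_def L_def by (rule sum_coprime_density_approx[OF n x P])
    then have "\<bar>A * V * (s * (\<Sum>j\<in>J. f j)) - A * V * (sieve_constant k * coprime_density (Suc k) P * x)\<bar>
        \<le> A * V * (2 ^ card P * exp 1 * (2 * L) ^ k)"
      unfolding right_diff_distrib[symmetric] abs_mult using A V by (simp add: mult_left_mono)
    also have "\<dots> \<le> A * real n ^ k * (2 ^ card P * exp 1 * (2 * L) ^ k)"
      using A V L by (intro mult_right_mono mult_left_mono) auto
    also have "\<dots> = A * exp 1 * 2 ^ k * 2 ^ card P * M ^ k"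
      by (simp add: M_def power_mult_distrib algebra_simps)
    finally have "M * \<bar>A * V * (s * (\<Sum>j\<in>J. f j)) - A * V * (sieve_constant k * coprime_density (Suc k) P * x)\<bar>
        \<le> M * (A * exp 1 * 2 ^ k * 2 ^ card P * M ^ k)"
      using M by (intro mult_left_mono)
    then have 2: "M * \<bar>A * V * (s * (\<Sum>j\<in>J. f j)) - A * V * (sieve_constant k * coprime_density (Suc k) P * x)\<bar>
        \<le> A * exp 1 * 2 ^ k * 2 ^ card P * M ^ Suc k" by (simp add: algebra_simps)
    have main: "(\<Prod>i<Suc k. sieve_constant i) * coprime_density (Suc k) P * (\<Prod>j=1..Suc k. X j)
        = A * V * (sieve_constant k * coprime_density (Suc k) P * x)"
      by (simp add: A_def V_def x_def algebra_simps)
    have "M * \<bar>(\<Sum>j\<in>J. N j) - A * V * (sieve_constant k * coprime_density (Suc k) P * x)\<bar>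
       \<le> M * (\<bar>(\<Sum>j\<in>J. N j) - A * V * (s * (\<Sum>j\<in>J. f j))\<bar>
          + \<bar>A * V * (s * (\<Sum>j\<in>J. f j)) - A * V * (sieve_constant k * coprime_density (Suc k) P * x)\<bar>)"
      using M by (intro mult_left_mono) linarith+
    also have "\<dots> \<le> K' * 2 ^ card P * M ^ Suc k"
      using 1 2 by (simp add: K'_def ring_distribs)
    finally show "(real n * (1 + ln (real n))) *
       \<bar>real (card (coprime_tuples (Suc k) X P)) -
         (\<Prod>i<Suc k. sieve_constant i) * coprime_density (Suc k) P * (\<Prod>j=1..Suc k. X j)\<bar>
     \<le> K' * 2 ^ card P * (real n * (1 + ln (real n))) ^ Suc k"
      unfolding main card M_def L_def .
  qed
qed

section \<open>From the tuple count to the discrepancy\<close>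

lemma G_approx:
  assumes "r \<ge> 1"
  shows "\<exists>A>0. \<exists>K>0. \<forall>n\<ge>1. \<forall>\<alpha>. (\<forall>j\<in>{1..r}. 0 \<le> \<alpha> j \<and> \<alpha> j \<le> 1) \<longrightarrow>
     \<bar>real (G r n \<alpha>) - A * real n ^ r * (\<Prod>j=1..r. \<alpha> j)\<bar>
       \<le> K * real n ^ (r - 1) * (1 + ln (real n)) ^ (r - 1)"
proof -
  define A where "A = (\<Prod>i<r. sieve_constant i)"
  obtain K where K: "K \<ge> 0" and approx: "\<And>n P X. n \<ge> 1 \<Longrightarrow> P \<in> prime_sets {} \<Longrightarrow>
      (\<And>j. j \<in> {1..r} \<Longrightarrow> 0 \<le> X j \<and> X j \<le> real n) \<Longrightarrow>
      (real n * (1 + ln (real n))) *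
       \<bar>real (card (coprime_tuples r X P)) - A * coprime_density r P * (\<Prod>j=1..r. X j)\<bar>
     \<le> K * 2 ^ card P * (real n * (1 + ln (real n))) ^ r"
    using card_coprime_tuples_approx[of r] unfolding A_def by blast
  show ?thesis
  proof (rule exI[of _ A], intro conjI, goal_cases)
    case 1
    show ?case unfolding A_def by (intro prod_pos) (simp add: sieve_constant_pos)
  next
    case 2
    show ?case
    proof (rule exI[of _ "K + 1"], intro conjI allI impI)
      show "K + 1 > 0" using K by simp
      fix n :: nat and \<alpha> :: "nat \<Rightarrow> real"
      assume n: "n \<ge> 1" and \<alpha>: "\<forall>j\<in>{1..r}. 0 \<le> \<alpha> j \<and> \<alpha> j \<le> 1"
      define M where "M = real n * (1 + ln (real n))"
      have M: "M > 0" using n by (simp add: M_def add_pos_nonneg)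
      have "real n * \<alpha> j \<le> real n" if "j \<in> {1..r}" for j
        using mult_left_mono[of "\<alpha> j" 1 "real n"] \<alpha> that by simp
      then have "M * \<bar>real (card (coprime_tuples r (\<lambda>j. real n * \<alpha> j) {})) -
            A * coprime_density r {} * (\<Prod>j=1..r. real n * \<alpha> j)\<bar> \<le> K * 2 ^ card ({}::nat set) * M ^ r"
        unfolding M_def using \<alpha> by (intro approx[OF n]) (auto simp: prime_sets_def)
      moreover have "coprime_tuples r (\<lambda>j. real n * \<alpha> j) {} = {x \<in> PC r. \<forall>j\<in>{1..r}. real (x j) \<le> real n * \<alpha> j}"
        by (simp add: coprime_tuples_def)
      ultimately have "M * \<bar>real (G r n \<alpha>) - A * real n ^ r * (\<Prod>j=1..r. \<alpha> j)\<bar> \<le> K * M ^ r"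
        by (simp add: G_def coprime_density_def prod.distrib algebra_simps)
      \<comment> \<open>Since \<open>r \<ge> 1\<close>, the normalizing factor \<open>M\<close> can
        be cancelled, which restores the exponent \<open>r - 1\<close>.\<close>
      also have "K * M ^ r = M * (K * M ^ (r - 1))"
        using assms by (cases r) auto
      finally have "\<bar>real (G r n \<alpha>) - A * real n ^ r * (\<Prod>j=1..r. \<alpha> j)\<bar> \<le> K * M ^ (r - 1)"
        using M by simp
      also have "\<dots> \<le> (K + 1) * M ^ (r - 1)" using M by (intro mult_right_mono) auto
      finally show "\<bar>real (G r n \<alpha>) - A * real n ^ r * (\<Prod>j=1..r. \<alpha> j)\<bar>
          \<le> (K + 1) * real n ^ (r - 1) * (1 + ln (real n)) ^ (r - 1)"
        unfolding M_def power_mult_distrib mult.assoc .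
    qed
  qed
qed

text \<open>Numerator and denominator share the error bound \<open>E\<close>, so
  \<open>G r n \<alpha>\<close> differs from \<open>a\<close> times the denominator by at most
  \<open>2 * E\<close>. A denominator of at least \<open>A * real n ^ r / 2\<close> then gives the
  constant 4.\<close>

lemma discrepancy_PC_le:
  assumes "r \<ge> 1"
  shows "\<exists>C>0. \<forall>n\<ge>1. discrepancy_PC r n \<le> C * (1 + ln (real n)) ^ (r - 1) / real n"
proof -
  obtain A K where A: "A > 0" and K: "K > 0" and approx: "\<And>n \<alpha>. n \<ge> 1 \<Longrightarrow>
      (\<And>j. j \<in> {1..r} \<Longrightarrow> 0 \<le> \<alpha> j \<and> \<alpha> j \<le> 1) \<Longrightarrow>
      \<bar>real (G r n \<alpha>) - A * real n ^ r * (\<Prod>j=1..r. \<alpha> j)\<bar>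
       \<le> K * real n ^ (r - 1) * (1 + ln (real n)) ^ (r - 1)"
    using G_approx[OF assms] by metis
  show ?thesis
  proof (intro exI[of _ "4 * K / A"] conjI allI impI)
    show "4 * K / A > 0" using A K by simp
    fix n :: nat assume n: "n \<ge> 1"
    define L where "L = (1 + ln (real n)) ^ (r - 1)"
    define E where "E = K * real n ^ (r - 1) * L"
    have L: "L > 0" using n by (simp add: L_def add_pos_nonneg)
    have E: "4 * E / (A * real n ^ r) = 4 * K / A * L / real n"
      using assms n by (cases r) (auto simp: E_def field_simps)
    have E0: "E \<ge> 0" using K L by (simp add: E_def)
    let ?g = "real (G r n (\<lambda>_. 1))"
    have g: "\<bar>?g - A * real n ^ r\<bar> \<le> E" using approx[OF n, of "\<lambda>_. 1"] by (simp add: E_def L_def)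
    have g0: "?g > 0" using G_one_pos[OF n] by simp
    have "discrepancy_PC r n \<le> 4 * E / (A * real n ^ r)"
      unfolding discrepancy_PC_def
    proof (rule cSUP_least)
      show "({1..r} \<rightarrow>\<^sub>E {0..1::real}) \<noteq> {}" by (simp add: PiE_eq_empty_iff)
      fix \<alpha> :: "nat \<Rightarrow> real" assume \<alpha>: "\<alpha> \<in> {1..r} \<rightarrow>\<^sub>E {0..1}"
      then have \<alpha>': "0 \<le> \<alpha> j \<and> \<alpha> j \<le> 1" if "j \<in> {1..r}" for j using that by (auto simp: PiE_iff)
      define a where "a = (\<Prod>j=1..r. \<alpha> j)"
      have a: "0 \<le> a" "a \<le> 1" unfolding a_def using \<alpha>' by (auto intro!: prod_nonneg prod_le_1)
      have G: "\<bar>real (G r n \<alpha>) - A * real n ^ r * a\<bar> \<le> E"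
        unfolding a_def E_def L_def by (rule approx[OF n \<alpha>'])
      show "\<bar>real (G r n \<alpha>) / ?g - a\<bar> \<le> 4 * E / (A * real n ^ r)"
      \<comment> \<open>If the error is too large for the denominator to be bounded below this way,
        the claimed bound exceeds 1 and holds trivially.\<close>
      proof (cases "2 * E \<le> A * real n ^ r")
        case True
        then have ge: "?g \<ge> A * real n ^ r / 2" using g by linarith
        have "\<bar>a * (A * real n ^ r - ?g)\<bar> \<le> 1 * E"
          unfolding abs_mult using a g by (intro mult_mono) auto
        then have "\<bar>real (G r n \<alpha>) - a * ?g\<bar> \<le> 2 * E"
          using G by (simp add: algebra_simps)
        moreover have "real (G r n \<alpha>) / ?g - a = (real (G r n \<alpha>) - a * ?g) / ?g"
          using g0 by (simp add: field_simps)
        ultimately have "\<bar>real (G r n \<alpha>) / ?g - a\<bar> \<le> 2 * E / ?g"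
          using g0 by (simp add: divide_right_mono)
        also have "\<dots> \<le> 2 * E / (A * real n ^ r / 2)"
          using ge E0 A n g0 by (intro divide_left_mono) auto
        finally show ?thesis by simp
      next
        case False
        have "real (G r n \<alpha>) / ?g \<le> 1" using G_le_G_one[OF \<alpha>, of n] g0 by simp
        moreover have "0 \<le> real (G r n \<alpha>) / ?g" by simp
        ultimately have "\<bar>real (G r n \<alpha>) / ?g - a\<bar> \<le> 1" using a by linarith
        also have "1 \<le> 4 * E / (A * real n ^ r)" using False A n E0 by (simp add: field_simps)
        finally show ?thesis .
      qed
    qed
    then show "discrepancy_PC r n \<le> 4 * K / A * (1 + ln (real n)) ^ (r - 1) / real n"
      unfolding E L_def .
  qed
qed

lemma discrepancy_PC_ge:
  assumes "r \<ge> 1" "n \<ge> 1"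
  shows "1 / 2 / real n \<le> discrepancy_PC r n"
proof -
  define \<alpha> where "\<alpha> = (\<lambda>j\<in>{1..r}. if j = 1 then 1 / 2 / real n else 1)"
  have \<alpha>: "\<alpha> \<in> {1..r} \<rightarrow>\<^sub>E {0..1}" using assms(2) by (auto simp: \<alpha>_def)
  have "{x \<in> PC r. \<forall>j\<in>{1..r}. real (x j) \<le> real n * \<alpha> j} = {}"
  proof (rule ccontr)
    assume "{x \<in> PC r. \<forall>j\<in>{1..r}. real (x j) \<le> real n * \<alpha> j} \<noteq> {}"
    then obtain x where "x \<in> PC r" "\<forall>j\<in>{1..r}. real (x j) \<le> real n * \<alpha> j" by blast
    then have x: "x \<in> PC r" "real (x 1) \<le> real n * \<alpha> 1" using assms(1) by auto
    have "x 1 \<ge> 1" using x(1) assms(1) by (auto simp: PC_def PiE_iff Suc_le_eq)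
    moreover have "real n * \<alpha> 1 = 1 / 2" using assms by (simp add: \<alpha>_def)
    ultimately show False using x(2) by linarith
  qed
  then have "G r n \<alpha> = 0" unfolding G_def by (simp only: card.empty)
  moreover have "(\<Prod>j=1..r. \<alpha> j) = 1 / 2 / real n"
  proof -
    have "(\<Prod>j=1..r. \<alpha> j) = (\<Prod>j\<in>{1..r}. if j = 1 then 1 / 2 / real n else 1)"
      by (intro prod.cong) (auto simp: \<alpha>_def)
    also have "\<dots> = 1 / 2 / real n" using assms(1) by (simp add: prod.delta)
    finally show ?thesis .
  qed
  ultimately have "1 / 2 / real n = \<bar>real (G r n \<alpha>) / real (G r n (\<lambda>_. 1)) - (\<Prod>j=1..r. \<alpha> j)\<bar>"
    by simp
  also have "\<dots> \<le> discrepancy_PC r n"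
    unfolding discrepancy_PC_def by (rule cSUP_upper[OF \<alpha> bdd_above_discrepancy_PC])
  finally show ?thesis .
qed

theorem theorem4p2:
  fixes r :: nat
  assumes "r \<ge> 2"
  shows "\<exists>c C :: real. 0 < c \<and> c < C \<and>
           (\<forall>n::nat. n \<ge> 2 \<longrightarrow>
              c / real n \<le> discrepancy_PC r n \<and>
              discrepancy_PC r n \<le> C * (ln (real n) ^ (r - 1) / real n))"
proof -
  have r: "r \<ge> 1" using assms by simp
  obtain C where C: "C > 0" "\<And>n. n \<ge> 1 \<Longrightarrow> discrepancy_PC r n \<le> C * (1 + ln (real n)) ^ (r - 1) / real n"
    using discrepancy_PC_le[OF r] by blast
  \<comment> \<open>For \<open>n \<ge> 2\<close> the summand 1 is at most
    \<open>ln n / ln 2\<close>, so \<open>1 + ln n\<close> is at most \<open>1 / ln 2 + 1\<close>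
    times \<open>ln n\<close>.\<close>
  define D where "D = C * (1 / ln 2 + 1) ^ (r - 1)"
  show ?thesis
  \<comment> \<open>Taking \<open>D + 1\<close> instead of \<open>D\<close> ensures that the upper
    constant exceeds \<open>1 / 2\<close>.\<close>
  proof (rule exI[of _ "1 / 2"], rule exI[of _ "D + 1"], intro conjI allI impI)
    have ln2: "ln (2::real) > 0" by simp
    have D: "D > 0" unfolding D_def using C ln2 by (intro mult_pos_pos zero_less_power add_pos_pos) auto
    then show "1 / 2 < D + 1" by simp
    fix n :: nat assume n: "n \<ge> 2"
    show "1 / 2 / real n \<le> discrepancy_PC r n" using n by (intro discrepancy_PC_ge r) simp
    have l: "ln (real n) \<ge> ln 2" using n by simp
    have "1 + ln (real n) \<le> (1 / ln 2 + 1) * ln (real n)"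
      using l ln2 by (simp add: field_simps)
    then have "(1 + ln (real n)) ^ (r - 1) \<le> ((1 / ln 2 + 1) * ln (real n)) ^ (r - 1)"
      using l ln2 by (intro power_mono) linarith+
    then have "C * (1 + ln (real n)) ^ (r - 1) / real n \<le> C * ((1 / ln 2 + 1) * ln (real n)) ^ (r - 1) / real n"
      using C by (intro divide_right_mono mult_left_mono) auto
    also have "\<dots> = D * (ln (real n) ^ (r - 1) / real n)"
      by (simp add: D_def power_mult_distrib)
    also have "\<dots> \<le> (D + 1) * (ln (real n) ^ (r - 1) / real n)"
      using n by (intro mult_right_mono divide_nonneg_nonneg zero_le_power) auto
    finally show "discrepancy_PC r n \<le> (D + 1) * (ln (real n) ^ (r - 1) / real n)"
      using C(2)[of n] n by linarith
  qed simp
qed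

end
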